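(* Let $\mathbb{F}$ be a field, $d\ge3$, $V$ a vector space over $\mathbb{F}$ of dimension $d+1$, and $\Phi=(A;\{E_i\}_{i=0}^d;A^*;\{E^*_i\}_{i=0}^d)$ a CH system on $V$ with eigenvalue sequence $\{\theta_i\}_{i=0}^d$, dual eigenvalue sequence $\{\theta^*_i\}_{i=0}^d$ and $\Phi$-split sequence $\{\phi_i\}_{i=1}^d$. Fix nonzero vectors $u^*\in E^*_0V$ and $u\in E_0V$, and let $\varepsilon\in\mathbb{F}$ be the scalar with $E_0u^*=\varepsilon u$. For $0\le i\le d$ let $v_i=(A-\theta_{d-i+1}I)\cdots(A-\theta_{d-1}I)(A-\theta_dI)u^*$ and $v^*_i=(A^*-\theta^*_{d-i+1}I)\cdots(A^*-\theta^*_{d-1}I)(A^*-\theta^*_dI)u$. Then the transition matrix from the basis $\{v^*_{d-i}\}_{i=0}^d$ to the basis $\{v_i\}_{i=0}^d$ of $V$ is diagonal with $(i,i)$-entry $$\frac{\varepsilon(\theta_0-\theta_1)(\theta_0-\theta_2)\cdots(\theta_0-\theta_d)}{\phi_{i+1}\phi_{i+2}\cdots\phi_d}$$ for $0\le i\le d$. Moreover, the transition matrix from $\{v_i\}_{i=0}^d$ to $\{v^*_{d-i}\}_{i=0}^d$ is diagonal with $(i,i)$-entry $$\frac{\phi_{i+1}\phi_{i+2}\cdots\phi_d}{\varepsilon(\theta_0-\theta_1)(\theta_0-\theta_2)\cdots(\theta_0-\theta_d)}$$ for $0\le i\le d$.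
   Context: Rows and columns of $(d+1)\times(d+1)$ matrices are indexed by $0,\dots,d$. A matrix $M$ represents $B\in\mathrm{End}(V)$ with respect to a basis $\{w_i\}_{i=0}^d$ if $Bw_j=\sum_iM_{ij}w_i$. An element of $\mathrm{End}(V)$ is multiplicity-free if it is diagonalizable with all eigenspaces of dimension one. The primitive idempotent of a multiplicity-free $B$ for an eigenvalue $\theta$ is the $E\in\mathrm{End}(V)$ acting as the identity on the $\theta$-eigenspace and as $0$ on the other eigenspaces. A CH system on $V$ is a sequence $\Phi=(A;\{E_i\}_{i=0}^d;A^*;\{E^*_i\}_{i=0}^d)$ in $\mathrm{End}(V)$ such that: (i) $A,A^*$ are multiplicity-free; (ii) $\{E_i\}$ is an ordering of the primitive idempotents of $A$; (iii) $\{E^*_i\}$ is an ordering of the primitive idempotents of $A^*$; (iv) $E_iA^*E_j=0$ if $1<i-j$ or $1<j-i<d$, and $E_iA^*E_j\neq0$ if $i-j=1$ or $j-i=d$; (v) $E^*_iAE^*_j=0$ if $1<i-j$ or $1<j-i<d$, and $E^*_iAE^*_j\neq0$ if $i-j=1$ or $j-i=d$ $(0\le i,j\le d)$. $\theta_i$ (resp. $\theta^*_i$) is the eigenvalue of $A$ (resp. $A^*$) corresponding to $E_i$ (resp. $E^*_i$). It is known that there is a unique sequence $\{\phi_i\}_{i=1}^d$ of nonzero scalars (the $\Phi$-split sequence) such that for some basis of $V$, $A$ is represented by the lower bidiagonal matrix with $(i,i)$-entry $\theta_{d-i}$ and $(i,i-1)$-entry $1$, and $A^*$ by the upper bidiagonal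 matrix with $(i,i)$-entry $\theta^*_i$ and $(i-1,i)$-entry $\phi_i$ (all other entries $0$). It is known that $\{v_i\}_{i=0}^d$ and $\{v^*_i\}_{i=0}^d$ are bases of $V$ and that $\varepsilon\neq0$. The transition matrix from a basis $\{x_i\}_{i=0}^d$ to a basis $\{y_i\}_{i=0}^d$ is the matrix $T$ with $y_j=\sum_{i=0}^dT_{ij}x_i$ for $0\le j\le d$. Empty products equal $1$. *)

theory Defs
  imports Main "HOL.Vector_Spaces"
begin

text \<open>
  The vector space \<open>V\<close> is the whole type \<open>'b\<close>, with scalars in the field \<open>'a\<close>. Sequences and
  square matrices indexed by \<open>0, \<dots>, d\<close> are functions on \<open>nat\<close>; only values at indices up to
  \<open>d\<close> matter. Primed names stand for the starred objects \<open>A\<^sup>*\<close>, \<open>E\<^sup>*\<^sub>i\<close>, \<open>\<theta>\<^sup>*\<^sub>i\<close>.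
\<close>

context vector_space
begin

definition is_basis :: "nat \<Rightarrow> (nat \<Rightarrow> 'b) \<Rightarrow> bool" where
  "is_basis d w \<longleftrightarrow>
     inj_on w {..d} \<and> independent (w ` {..d}) \<and> span (w ` {..d}) = UNIV"

definition represents :: "nat \<Rightarrow> (nat \<Rightarrow> nat \<Rightarrow> 'a) \<Rightarrow> ('b \<Rightarrow> 'b) \<Rightarrow> (nat \<Rightarrow> 'b) \<Rightarrow> bool" where
  "represents d M B w \<longleftrightarrow> (\<forall>j\<le>d. B (w j) = (\<Sum>i\<le>d. M i j *s w i))"

definition is_transition_matrix ::
    "nat \<Rightarrow> (nat \<Rightarrow> 'b) \<Rightarrow> (nat \<Rightarrow> 'b) \<Rightarrow> (nat \<Rightarrow> nat \<Rightarrow> 'a) \<Rightarrow> bool" where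
  "is_transition_matrix d x y T \<longleftrightarrow>
     is_basis d x \<and> is_basis d y \<and> (\<forall>j\<le>d. y j = (\<Sum>i\<le>d. T i j *s x i))"

definition eigenspace :: "('b \<Rightarrow> 'b) \<Rightarrow> 'a \<Rightarrow> 'b set" where
  "eigenspace B t = {v. B v = t *s v}"

definition is_eigenvalue :: "('b \<Rightarrow> 'b) \<Rightarrow> 'a \<Rightarrow> bool" where
  "is_eigenvalue B t \<longleftrightarrow> (\<exists>v. v \<noteq> 0 \<and> B v = t *s v)"

definition diagonalizable :: "('b \<Rightarrow> 'b) \<Rightarrow> bool" where
  "diagonalizable B \<longleftrightarrow>
     (\<exists>S. independent S \<and> span S = UNIV \<and> (\<forall>v\<in>S. \<exists>t. B v = t *s v))"

definition multiplicity_free :: "('b \<Rightarrow> 'b) \<Rightarrow> bool" where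
  "multiplicity_free B \<longleftrightarrow>
     Vector_Spaces.linear scale scale B \<and> diagonalizable B \<and>
     (\<forall>t. is_eigenvalue B t \<longrightarrow> dim (eigenspace B t) = 1)"

definition is_primitive_idempotent :: "('b \<Rightarrow> 'b) \<Rightarrow> 'a \<Rightarrow> ('b \<Rightarrow> 'b) \<Rightarrow> bool" where
  "is_primitive_idempotent B t P \<longleftrightarrow>
     is_eigenvalue B t \<and> Vector_Spaces.linear scale scale P \<and>
     (\<forall>v\<in>eigenspace B t. P v = v) \<and>
     (\<forall>s. is_eigenvalue B s \<and> s \<noteq> t \<longrightarrow> (\<forall>v\<in>eigenspace B s. P v = 0))"

definition is_idempotent_ordering :: "nat \<Rightarrow> ('b \<Rightarrow> 'b) \<Rightarrow> (nat \<Rightarrow> 'b \<Rightarrow> 'b) \<Rightarrow> bool" where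
  "is_idempotent_ordering d B E \<longleftrightarrow>
     bij_betw E {..d} {P. \<exists>t. is_primitive_idempotent B t P}"

text \<open>The index differences are taken in \<open>int\<close>, since subtraction on \<open>nat\<close> truncates.\<close>

definition CH_pattern :: "nat \<Rightarrow> (nat \<Rightarrow> 'b \<Rightarrow> 'b) \<Rightarrow> ('b \<Rightarrow> 'b) \<Rightarrow> bool" where
  "CH_pattern d E B \<longleftrightarrow>
     (\<forall>i\<le>d. \<forall>j\<le>d.
        (1 < int i - int j \<or> (1 < int j - int i \<and> int j - int i < int d)
           \<longrightarrow> E i \<circ> B \<circ> E j = (\<lambda>_. 0)) \<and>
        (int i - int j = 1 \<or> int j - int i = int d
           \<longrightarrow> E i \<circ> B \<circ> E j \<noteq> (\<lambda>_. 0)))"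

definition CH_system ::
    "nat \<Rightarrow> ('b \<Rightarrow> 'b) \<Rightarrow> (nat \<Rightarrow> 'b \<Rightarrow> 'b) \<Rightarrow> ('b \<Rightarrow> 'b) \<Rightarrow> (nat \<Rightarrow> 'b \<Rightarrow> 'b) \<Rightarrow> bool" where
  "CH_system d A E A' E' \<longleftrightarrow>
     multiplicity_free A \<and> multiplicity_free A' \<and>
     is_idempotent_ordering d A E \<and> is_idempotent_ordering d A' E' \<and>
     CH_pattern d E A' \<and> CH_pattern d E' A"

definition is_eigenvalue_sequence ::
    "nat \<Rightarrow> ('b \<Rightarrow> 'b) \<Rightarrow> (nat \<Rightarrow> 'b \<Rightarrow> 'b) \<Rightarrow> (nat \<Rightarrow> 'a) \<Rightarrow> bool" where
  "is_eigenvalue_sequence d B E \<theta> \<longleftrightarrow> (\<forall>i\<le>d. is_primitive_idempotent B (\<theta> i) (E i))"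

definition is_split_sequence ::
    "nat \<Rightarrow> ('b \<Rightarrow> 'b) \<Rightarrow> ('b \<Rightarrow> 'b) \<Rightarrow> (nat \<Rightarrow> 'a) \<Rightarrow> (nat \<Rightarrow> 'a) \<Rightarrow> (nat \<Rightarrow> 'a) \<Rightarrow> bool" where
  "is_split_sequence d A A' \<theta> \<theta>' \<phi> \<longleftrightarrow>
     (\<forall>i\<in>{1..d}. \<phi> i \<noteq> 0) \<and>
     (\<exists>w. is_basis d w \<and>
        represents d (\<lambda>i j. if i = j then \<theta> (d - i) else if i = j + 1 then 1 else 0) A w \<and>
        represents d (\<lambda>i j. if i = j then \<theta>' i else if j = i + 1 then \<phi> j else 0) A' w)"

text \<open>
  For \<open>i \<le> d\<close>, \<open>eigen_prod d B t x i\<close> is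
  \<open>(B - t\<^bsub>d-i+1\<^esub> I) \<cdots> (B - t\<^bsub>d-1\<^esub> I) (B - t\<^bsub>d\<^esub> I) x\<close>.
\<close>

primrec eigen_prod :: "nat \<Rightarrow> ('b \<Rightarrow> 'b) \<Rightarrow> (nat \<Rightarrow> 'a) \<Rightarrow> 'b \<Rightarrow> nat \<Rightarrow> 'b" where
  "eigen_prod d B t x 0 = x"
| "eigen_prod d B t x (Suc i) =
     B (eigen_prod d B t x i) - t (d - i) *s eigen_prod d B t x i"

end

end

theory Submission
  imports Defs
begin

text \<open>
  Let \<open>w\<close> be a basis in which \<open>A\<close> and \<open>A\<^sup>*\<close> have the split form. Then \<open>w\<^sub>0\<close> spans \<open>E\<^sup>*\<^sub>0V\<close> and
  \<open>w\<^sub>d\<close> spans \<open>E\<^sub>0V\<close>, so \<open>u\<^sup>* = c w\<^sub>0\<close> and \<open>u = b w\<^sub>d\<close>, whence \<open>v\<^sub>i = c w\<^sub>i\<close> and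
  \<open>v\<^sup>*\<^bsub>d-i\<^esub> = b \<phi>\<^bsub>i+1\<^esub> \<cdots> \<phi>\<^sub>d w\<^sub>i\<close>. Applying \<open>E\<^sub>0\<close>, which satisfies \<open>E\<^sub>0A = \<theta>\<^sub>0E\<^sub>0\<close>, to
  \<open>w\<^bsub>i+1\<^esub> = (A - \<theta>\<^bsub>d-i\<^esub>I) w\<^sub>i\<close> gives \<open>w\<^sub>d = (\<theta>\<^sub>0 - \<theta>\<^sub>1) \<cdots> (\<theta>\<^sub>0 - \<theta>\<^sub>d) E\<^sub>0w\<^sub>0\<close>; comparison with
  \<open>E\<^sub>0u\<^sup>* = \<epsilon>u\<close> yields \<open>c = b \<epsilon> (\<theta>\<^sub>0 - \<theta>\<^sub>1) \<cdots> (\<theta>\<^sub>0 - \<theta>\<^sub>d)\<close>.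
\<close>

context vector_space
begin

text \<open>Both identities are linear in \<open>x\<close>, so it suffices to check them on a
  spanning set of eigenvectors: \<open>P\<close> fixes those for \<open>t\<close> and kills the
  others.\<close>

lemma primitive_idempotent_commute:
  assumes "multiplicity_free B" "is_primitive_idempotent B t P"
  shows "B (P x) = t *s P x" and "P (B x) = t *s P x"
proof -
  interpret B: Vector_Spaces.linear scale scale B
    using assms(1) by (simp add: multiplicity_free_def)
  interpret P: Vector_Spaces.linear scale scale P
    using assms(2) by (simp add: is_primitive_idempotent_def)
  obtain S where S: "independent S" "span S = UNIV" "\<forall>v\<in>S. \<exists>t. B v = t *s v"
    using assms(1) by (auto simp: multiplicity_free_def diagonalizable_def)
  have eig: "B (P v) = t *s P v \<and> P (B v) = t *s P v" if "v \<in> S" for v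
  proof -
    obtain s where s: "B v = s *s v"
      using S(3) \<open>v \<in> S\<close> by blast
    \<comment> \<open>Being nonzero makes \<open>s\<close> a genuine eigenvalue, which the vanishing
      clause for \<open>P\<close> requires.\<close>
    have "v \<noteq> 0" using S(1) that dependent_zero[of S] by metis
    with s have ev: "is_eigenvalue B s" by (auto simp: is_eigenvalue_def)
    show ?thesis
    proof (cases "s = t")
      case True
      then have "P v = v"
        using assms(2) s by (auto simp: is_primitive_idempotent_def eigenspace_def)
      then show ?thesis using s True by (simp add: P.scale)
    next
      case False
      then have "P v = 0"
        using assms(2) s ev by (auto simp: is_primitive_idempotent_def eigenspace_def)
      then show ?thesis using s by (simp add: P.scale B.zero)
    qed
  qed
  have "x \<in> span S" by (simp add: S(2))
  then have "B (P x) = t *s P x \<and> P (B x) = t *s P x"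
    by (induction rule: span_induct_alt)
      (simp_all add: eig B.zero P.zero B.add P.add B.scale P.scale scale_right_distrib mult.commute)
  then show "B (P x) = t *s P x" and "P (B x) = t *s P x" by auto
qed

text \<open>The eigenspace is a line, so \<open>x\<close> and \<open>y\<close> are nonzero multiples
  of one spanning vector. This will identify \<open>u'\<close> and \<open>u\<close> up to scalars
  with the first and last vectors of the split basis.\<close>

lemma multiplicity_free_eigenvector_multiple:
  assumes "multiplicity_free B" "B x = t *s x" "x \<noteq> 0" "B y = t *s y" "y \<noteq> 0"
  obtains c where "c \<noteq> 0" "y = c *s x"
proof -
  have "is_eigenvalue B t" using assms(2,3) by (auto simp: is_eigenvalue_def)
  then have "dim (eigenspace B t) = 1" using assms(1) by (simp add: multiplicity_free_def)
  then obtain z where z: "eigenspace B t \<subseteq> span {z}"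
    using basis_exists[of "eigenspace B t"] by (metis card_1_singletonE)
  have "x \<in> span {z}" "y \<in> span {z}" using z assms by (auto simp: eigenspace_def)
  then obtain a b where ab: "x = a *s z" "y = b *s z" by (auto simp: span_singleton)
  then have "a \<noteq> 0" "b \<noteq> 0" using assms by auto
  then show thesis using ab by (intro that[of "b / a"]) auto
qed

lemma is_basis_nonzero:
  assumes "is_basis d w" "i \<le> d"
  shows "w i \<noteq> 0"
  using assms dependent_zero by (force simp: is_basis_def)

lemma is_basis_scale:
  assumes "is_basis d w" "\<And>i. i \<le> d \<Longrightarrow> a i \<noteq> 0" "\<And>i. i \<le> d \<Longrightarrow> x i = a i *s w i"
  shows "is_basis d x"
proof -
  have inj: "inj_on w {..d}" and ind: "independent (w ` {..d})"
    and sp: "span (w ` {..d}) = UNIV"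
    using assms(1) by (auto simp: is_basis_def)
  have w_x: "w i = (1 / a i) *s x i" if "i \<le> d" for i
    using that assms(2,3) by simp
  \<comment> \<open>The hyperplane \<open>?H i\<close> contains every \<open>x j\<close> with
    \<open>j \<noteq> i\<close> but not \<open>x i\<close>; this yields both injectivity and
    independence of \<open>x\<close>.\<close>
  let ?H = "\<lambda>i. span (w ` ({..d} - {i}))"
  have notin: "x i \<notin> ?H i" if "i \<le> d" for i
  proof
    assume "x i \<in> ?H i"
    then have "w i \<in> ?H i" using w_x[OF that] by (metis span_scale)
    moreover have "w ` ({..d} - {i}) = w ` {..d} - {w i}"
      using inj that by (auto simp: inj_on_def)
    ultimately show False using ind that by (auto simp: dependent_def)
  qed
  have x_in: "x j \<in> ?H i" if "j \<le> d" "j \<noteq> i" for i j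
    unfolding assms(3)[OF that(1)] using that by (intro span_scale span_base) auto
  have "inj_on x {..d}"
    by (rule inj_onI) (metis atMost_iff notin x_in)
  moreover have "independent (x ` {..d})"
    unfolding dependent_def
  proof clarsimp
    fix i assume "i \<le> d" and mem: "x i \<in> span (x ` {..d} - {x i})"
    have "x ` {..d} - {x i} \<subseteq> ?H i"
      by clarify (metis atMost_iff x_in)
    then have "span (x ` {..d} - {x i}) \<subseteq> ?H i" by (rule span_minimal) simp
    then show False using mem notin \<open>i \<le> d\<close> by blast
  qed
  moreover have "span (w ` {..d}) \<subseteq> span (x ` {..d})"
  proof (rule span_minimal)
    show "w ` {..d} \<subseteq> span (x ` {..d})"
    proof (rule image_subsetI)
      fix i assume "i \<in> {..d}"
      then show "w i \<in> span (x ` {..d})"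
        using w_x[of i] by (metis atMost_iff imageI span_base span_scale)
    qed
  qed simp
  ultimately show ?thesis using sp by (auto simp: is_basis_def)
qed

lemma is_transition_matrix_diagonal:
  assumes "is_basis d x" "is_basis d y" "\<And>i. i \<le> d \<Longrightarrow> y i = D i *s x i"
  shows "is_transition_matrix d x y (\<lambda>i j. if i = j then D i else 0)"
proof -
  have "(\<Sum>i\<le>d. (if i = j then D i else 0) *s x i) = D j *s x j" if "j \<le> d" for j
    using that by (simp add: if_distrib[of "\<lambda>c. c *s _"] sum.delta cong: if_cong)
  then show ?thesis using assms by (simp add: is_transition_matrix_def)
qed

text \<open>Each factor moves one step along \<open>w\<close> and contributes one \<psi>. Leaving
  \<open>w\<close> and \<psi> general covers both \<open>A\<close> on the split basis and
  \<open>A'\<close> on the reversed one.\<close>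

lemma eigen_prod_scaled_basis:
  assumes "Vector_Spaces.linear scale scale B"
    and "\<And>i. i < d \<Longrightarrow> B (w i) - t (d - i) *s w i = \<psi> i *s w (Suc i)"
    and "i \<le> d"
  shows "eigen_prod d B t (c *s w 0) i = (c * (\<Prod>k<i. \<psi> k)) *s w i"
  using assms(3)
proof (induction i)
  case (Suc i)
  interpret B: Vector_Spaces.linear scale scale B by fact
  let ?a = "c * (\<Prod>k<i. \<psi> k)"
  have "eigen_prod d B t (c *s w 0) (Suc i) = ?a *s (B (w i) - t (d - i) *s w i)"
    using Suc by (simp add: B.scale scale_right_diff_distrib mult.commute)
  then show ?case using assms(2)[of i] Suc.prems by (simp add: mult.assoc)
qed simp

lemma represents_lower_bidiagonal:
  assumes "represents d (\<lambda>i j. if i = j then a i else if i = j + 1 then b i else 0) B w"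
    and "j \<le> d"
  shows "B (w j) = a j *s w j + (if j < d then b (Suc j) *s w (Suc j) else 0)"
proof -
  \<comment> \<open>Column \<open>j\<close> splits into two one-point sums; for \<open>j = d\<close>
    the second has its point outside the range and vanishes.\<close>
  have "B (w j) = (\<Sum>i\<le>d. (if i = j then a i *s w i else 0)
      + (if i = Suc j then b i *s w i else 0))"
    using assms unfolding represents_def by (auto intro!: sum.cong)
  then show ?thesis using assms(2) by (auto simp: sum.distrib Suc_le_eq)
qed

lemma represents_upper_bidiagonal:
  assumes "represents d (\<lambda>i j. if i = j then a i else if j = i + 1 then b j else 0) B w"
    and "j \<le> d"
  shows "B (w j) = a j *s w j + (if 0 < j then b j *s w (j - 1) else 0)"
proof -
  \<comment> \<open>The guard \<open>0 < j\<close> is needed because \<open>j - 1\<close> truncates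
    to 0 at \<open>j = 0\<close>.\<close>
  have "B (w j) = (\<Sum>i\<le>d. (if i = j then a i *s w i else 0)
      + (if 0 < j \<and> i = j - 1 then b j *s w i else 0))"
    using assms unfolding represents_def by (auto intro!: sum.cong)
  then show ?thesis using assms(2) by (cases j) (auto simp: sum.distrib)
qed

lemma split_transition_matrices:
  assumes "multiplicity_free A" "multiplicity_free A'"
    and "is_primitive_idempotent A (\<theta> 0) P" "is_primitive_idempotent A' (\<theta>' 0) P'"
    and "is_split_sequence d A A' \<theta> \<theta>' \<phi>"
    and "u' \<in> range P'" "u' \<noteq> 0" "u \<in> range P" "u \<noteq> 0" "P u' = \<epsilon> *s u"
    and "\<And>i. i \<le> d \<Longrightarrow> v i = eigen_prod d A \<theta> u' i"
    and "\<And>i. i \<le> d \<Longrightarrow> v' i = eigen_prod d A' \<theta>' u i"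
  shows "is_transition_matrix d (\<lambda>i. v' (d - i)) v
           (\<lambda>i j. if i = j then \<epsilon> * (\<Prod>k=1..d. \<theta> 0 - \<theta> k) / (\<Prod>k=i+1..d. \<phi> k) else 0)"
    and "is_transition_matrix d v (\<lambda>i. v' (d - i))
           (\<lambda>i j. if i = j then (\<Prod>k=i+1..d. \<phi> k) / (\<epsilon> * (\<Prod>k=1..d. \<theta> 0 - \<theta> k)) else 0)"
proof -
  interpret P: Vector_Spaces.linear scale scale P
    using assms(3) by (simp add: is_primitive_idempotent_def)
  have linA: "Vector_Spaces.linear scale scale A" and linA': "Vector_Spaces.linear scale scale A'"
    using assms(1,2) by (simp_all add: multiplicity_free_def)
  obtain w where w: "is_basis d w"
    and rA: "represents d (\<lambda>i j. if i = j then \<theta> (d - i) else if i = j + 1 then 1 else 0) A w"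
    and rA': "represents d (\<lambda>i j. if i = j then \<theta>' i else if j = i + 1 then \<phi> j else 0) A' w"
    and \<phi>: "\<And>i. i \<in> {1..d} \<Longrightarrow> \<phi> i \<noteq> 0"
    using assms(5) by (auto simp: is_split_sequence_def)
  note Aw = represents_lower_bidiagonal[OF rA] and A'w = represents_upper_bidiagonal[OF rA']
  have w0: "w 0 \<noteq> 0" and wd: "w d \<noteq> 0" using is_basis_nonzero[OF w] by auto
  obtain c where c: "c \<noteq> 0" "u' = c *s w 0"
  proof (rule multiplicity_free_eigenvector_multiple[OF assms(2)])
    show "A' (w 0) = \<theta>' 0 *s w 0" using A'w[of 0] by simp
    show "A' u' = \<theta>' 0 *s u'"
      using assms(6) primitive_idempotent_commute(1)[OF assms(2,4)] by auto
  qed (use w0 assms(7) in auto)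
  \<comment> \<open>The last column has no subdiagonal entry, and its diagonal entry is
    \<open>\<theta> (d - d)\<close>.\<close>
  have Awd: "A (w d) = \<theta> 0 *s w d" using Aw[of d] by simp
  obtain b where b: "b \<noteq> 0" "u = b *s w d"
  proof (rule multiplicity_free_eigenvector_multiple[OF assms(1) Awd])
    show "A u = \<theta> 0 *s u"
      using assms(8) primitive_idempotent_commute(1)[OF assms(1,3)] by auto
  qed (use wd assms(9) in auto)
  have v: "v i = c *s w i" if "i \<le> d" for i
    using eigen_prod_scaled_basis[OF linA, of d w \<theta> "\<lambda>_. 1" i c] Aw assms(11) that c by simp
  define \<Pi> where "\<Pi> i = (\<Prod>k=i+1..d. \<phi> k)" for i
  have \<Pi>_nz: "\<Pi> i \<noteq> 0" for i
    using \<phi> by (auto simp: \<Pi>_def)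
  have v': "v' (d - i) = (b * \<Pi> i) *s w i" if "i \<le> d" for i
  proof -
    \<comment> \<open>Reversing the basis makes the upper bidiagonal \<open>A'\<close> lower
      bidiagonal, with diagonal entries in the order in which \<open>eigen_prod\<close> subtracts
      them.\<close>
    have step: "A' (w (d - j)) - \<theta>' (d - j) *s w (d - j) = \<phi> (d - j) *s w (d - Suc j)"
      if "j < d" for j
      using A'w[of "d - j"] that by simp
    have "v' (d - i) = (b * (\<Prod>k<d - i. \<phi> (d - k))) *s w i"
      using eigen_prod_scaled_basis[OF linA', of d "\<lambda>j. w (d - j)" \<theta>' "\<lambda>k. \<phi> (d - k)", OF step]
        assms(12) b that by simp
    also have "(\<Prod>k<d - i. \<phi> (d - k)) = \<Pi> i"
      unfolding \<Pi>_def using that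
      by (intro prod.reindex_bij_witness[of _ "\<lambda>k. d - k" "\<lambda>k. d - k"]) auto
    finally show ?thesis .
  qed
  define Q where "Q = (\<Prod>k=1..d. \<theta> 0 - \<theta> k)"
  \<comment> \<open>Since \<open>P\<close> turns \<open>A\<close> into the scalar
    \<open>\<theta> 0\<close>, each step along the split basis multiplies the image under
    \<open>P\<close> by \<open>\<theta> 0 - \<theta> (d - i)\<close>.\<close>
  have Pw: "P (w i) = (\<Prod>k<i. \<theta> 0 - \<theta> (d - k)) *s P (w 0)" if "i \<le> d" for i
    using that
  proof (induction i)
    case (Suc i)
    then have "w (Suc i) = A (w i) - \<theta> (d - i) *s w i" using Aw[of i] by simp
    then have "P (w (Suc i)) = (\<theta> 0 - \<theta> (d - i)) *s P (w i)"
      by (simp add: P.diff P.scale primitive_idempotent_commute(2)[OF assms(1,3)]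
          scale_left_diff_distrib)
    with Suc show ?case by (simp add: mult.commute)
  qed simp
  have "P (w d) = w d"
    using assms(3) Awd by (auto simp: is_primitive_idempotent_def eigenspace_def)
  moreover have "(\<Prod>k<d. \<theta> 0 - \<theta> (d - k)) = Q"
    unfolding Q_def by (intro prod.reindex_bij_witness[of _ "\<lambda>k. d - k" "\<lambda>k. d - k"]) auto
  ultimately have "w d = Q *s P (w 0)" using Pw[of d] by simp
  then have "c *s w d = Q *s P u'" using c by (simp add: P.scale mult.commute)
  also have "\<dots> = (b * (\<epsilon> * Q)) *s w d" using assms(10) b by (simp add: ac_simps)
  \<comment> \<open>Coefficients of the nonzero vector \<open>w d\<close> are compared. As
    \<open>c\<close> is nonzero, so is \<open>\<epsilon> * Q\<close>, the denominator of the second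
    matrix.\<close>
  finally have cb: "c = b * (\<epsilon> * Q)" using wd by simp
  then have \<epsilon>Q: "\<epsilon> * Q \<noteq> 0" using c by auto
  have bv: "is_basis d v" using is_basis_scale[OF w _ v] c by simp
  have bv': "is_basis d (\<lambda>i. v' (d - i))" using is_basis_scale[OF w _ v'] b \<Pi>_nz by simp
  show "is_transition_matrix d (\<lambda>i. v' (d - i)) v
      (\<lambda>i j. if i = j then \<epsilon> * (\<Prod>k=1..d. \<theta> 0 - \<theta> k) / (\<Prod>k=i+1..d. \<phi> k) else 0)"
    unfolding Q_def[symmetric] \<Pi>_def[symmetric]
    \<comment> \<open>The ratio of the coefficients of \<open>v i\<close> and
      \<open>v' (d - i)\<close> is \<open>c / (b * \<Pi> i)\<close>, and \<open>cb\<close> cancels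
      \<open>b\<close>.\<close>
    using v v' \<Pi>_nz cb by (intro is_transition_matrix_diagonal bv bv') (simp add: field_simps)
  show "is_transition_matrix d v (\<lambda>i. v' (d - i))
      (\<lambda>i j. if i = j then (\<Prod>k=i+1..d. \<phi> k) / (\<epsilon> * (\<Prod>k=1..d. \<theta> 0 - \<theta> k)) else 0)"
    unfolding Q_def[symmetric] \<Pi>_def[symmetric]
    using v v' \<epsilon>Q cb by (intro is_transition_matrix_diagonal bv bv') (simp add: field_simps)
qed

end

theorem lemma6p7:
  fixes scale :: "'a::field \<Rightarrow> 'b::ab_group_add \<Rightarrow> 'b"
    and d :: nat
    and A A' :: "'b \<Rightarrow> 'b"
    and E E' :: "nat \<Rightarrow> 'b \<Rightarrow> 'b"
    and \<theta> \<theta>' \<phi> :: "nat \<Rightarrow> 'a"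
    and u u' :: 'b
    and \<epsilon> :: 'a
    and v v' :: "nat \<Rightarrow> 'b"
  assumes "vector_space scale"
    and "d \<ge> 3"
    and "vector_space.dim scale (UNIV :: 'b set) = d + 1"
    and "vector_space.CH_system scale d A E A' E'"
    and "vector_space.is_eigenvalue_sequence scale d A E \<theta>"
    and "vector_space.is_eigenvalue_sequence scale d A' E' \<theta>'"
    and "vector_space.is_split_sequence scale d A A' \<theta> \<theta>' \<phi>"
    and "u' \<in> range (E' 0)" and "u' \<noteq> 0"
    and "u \<in> range (E 0)" and "u \<noteq> 0"
    and "E 0 u' = scale \<epsilon> u"
    and "\<And>i. i \<le> d \<Longrightarrow> v i = vector_space.eigen_prod scale d A \<theta> u' i"
    and "\<And>i. i \<le> d \<Longrightarrow> v' i = vector_space.eigen_prod scale d A' \<theta>' u i"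
  shows "vector_space.is_transition_matrix scale d (\<lambda>i. v' (d - i)) v
           (\<lambda>i j. if i = j
                  then \<epsilon> * (\<Prod>k=1..d. \<theta> 0 - \<theta> k) / (\<Prod>k=i+1..d. \<phi> k)
                  else 0) \<and>
         vector_space.is_transition_matrix scale d v (\<lambda>i. v' (d - i))
           (\<lambda>i j. if i = j
                  then (\<Prod>k=i+1..d. \<phi> k) / (\<epsilon> * (\<Prod>k=1..d. \<theta> 0 - \<theta> k))
                  else 0)"
proof -
  interpret vector_space scale by fact
  have mf: "multiplicity_free A" "multiplicity_free A'"
    using assms(4) by (simp_all add: CH_system_def)
  have pi: "is_primitive_idempotent A (\<theta> 0) (E 0)" "is_primitive_idempotent A' (\<theta>' 0) (E' 0)"
    using assms(5,6) by (simp_all add: is_eigenvalue_sequence_def)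
  show ?thesis
    using split_transition_matrices[OF mf pi assms(7-14)] by blast
qed

end
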